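(* Let $(X,\mathbb{F})$ be a non-autonomous system generated by a family $\mathbb{F}=(f_n)$ commuting with a map $f$. If $(f_n)$ converges strongly to $f$, then $(X,\mathbb{F})$ is regionally proximal if and only if $(X,f)$ is regionally proximal.
   Context: A non-autonomous system $(X,\mathbb{F})$ consists of a compact metric space $(X,d_X)$ and a sequence $\mathbb{F}=(f_n)_{n\ge 1}$ of surjective continuous self-maps of $X$; $\omega_n=f_n\circ\cdots\circ f_1$. $\mathbb{F}$ commutes with $f$ if $f_n\circ f=f\circ f_n$ for all $n$. $(X,f)$ denotes the autonomous system, for which $\omega_n=f^n$. $D_{C(X)}(g,h)=\sup_{x\in X}d_X(g(x),h(x))$ for continuous self-maps $g,h$ of $X$. $(f_n)$ converges strongly to the continuous map $f:X\to X$ if $\sum_{n=1}^\infty D_{C(X)}(f_n,f)<\infty$. A pair $(x,y)\in X\times X$ is regionally proximal for a system if for every $\epsilon>0$ and all neighborhoods $U$ of $x$ and $V$ of $y$ there are $z_1\in U$, $z_2\in V$ such that $\{n\in\mathbb{N}: d_X(\omega_n(z_1),\omega_n(z_2))<\epsilon\}$ is non-empty. A system on $X$ is regionally proximal if every pair in $X\times X$ is regionally proximal for it. *)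

theory Defs
  imports "HOL-Analysis.Analysis"
begin

text \<open>The space X is the carrier of a type of class metric_space, with compact UNIV.
  Families are indexed from 1: the value F 0 is never used.\<close>

definition nonautonomous_system :: "(nat \<Rightarrow> 'a::metric_space \<Rightarrow> 'a) \<Rightarrow> bool" where
  "nonautonomous_system F \<longleftrightarrow>
     compact (UNIV :: 'a set) \<and> (\<forall>n\<ge>1. continuous_on UNIV (F n) \<and> surj (F n))"

primrec omega :: "(nat \<Rightarrow> 'a \<Rightarrow> 'a) \<Rightarrow> nat \<Rightarrow> 'a \<Rightarrow> 'a" where
  "omega F 0 = id"
| "omega F (Suc n) = F (Suc n) \<circ> omega F n"

text \<open>The autonomous system (X, f) is the one generated by the constant family.\<close>

lemma omega_const: "omega (\<lambda>_. f) n = f ^^ n"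
  by (induction n) simp_all

definition commutes_with :: "(nat \<Rightarrow> 'a \<Rightarrow> 'a) \<Rightarrow> ('a \<Rightarrow> 'a) \<Rightarrow> bool" where
  "commutes_with F f \<longleftrightarrow> (\<forall>n\<ge>1. F n \<circ> f = f \<circ> F n)"

text \<open>On a compact space the set of distances is bounded, so this real supremum is genuine.\<close>

definition sup_dist :: "('a::metric_space \<Rightarrow> 'a) \<Rightarrow> ('a \<Rightarrow> 'a) \<Rightarrow> real" where
  "sup_dist g h = (SUP x. dist (g x) (h x))"

definition converges_strongly :: "(nat \<Rightarrow> 'a::metric_space \<Rightarrow> 'a) \<Rightarrow> ('a \<Rightarrow> 'a) \<Rightarrow> bool" where
  "converges_strongly F f \<longleftrightarrow> summable (\<lambda>n. sup_dist (F (Suc n)) f)"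

text \<open>Times n range over the positive integers.\<close>

definition regionally_proximal_pair ::
    "(nat \<Rightarrow> 'a::metric_space \<Rightarrow> 'a) \<Rightarrow> 'a \<Rightarrow> 'a \<Rightarrow> bool" where
  "regionally_proximal_pair F x y \<longleftrightarrow>
     (\<forall>\<epsilon>>0. \<forall>U V. open U \<and> x \<in> U \<and> open V \<and> y \<in> V \<longrightarrow>
        (\<exists>z1\<in>U. \<exists>z2\<in>V. {n. n \<ge> 1 \<and> dist (omega F n z1) (omega F n z2) < \<epsilon>} \<noteq> {}))"

definition regionally_proximal :: "(nat \<Rightarrow> 'a::metric_space \<Rightarrow> 'a) \<Rightarrow> bool" where
  "regionally_proximal F \<longleftrightarrow> (\<forall>x y. regionally_proximal_pair F x y)"

end

theory Submission
  imports Defs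
begin

text \<open>Since F commutes with f, the orbit distance between \<open>\<omega>\<^sub>k\<^sub>+\<^sub>n\<close> and \<open>f\<^sup>n \<circ> \<omega>\<^sub>k = \<omega>\<^sub>k \<circ> f\<^sup>n\<close> is at
  most the tail sum of \<open>D(f\<^sub>i, f)\<close> over \<open>i > k\<close>, uniformly in n. Fix k with a small tail.
  If f brings \<open>z\<^sub>1, z\<^sub>2\<close> close at time n, then uniform continuity of \<open>\<omega>\<^sub>k\<close> makes
  \<open>\<omega>\<^sub>k (f\<^sup>n z\<^sub>i)\<close>, hence \<open>\<omega>\<^sub>k\<^sub>+\<^sub>n z\<^sub>i\<close>, close. Conversely, pull the target neighbourhoods back along the
  surjection \<open>\<omega>\<^sub>k\<close>; if F brings points \<open>z\<^sub>1, z\<^sub>2\<close> of the preimages sufficiently close, it keeps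
  them close up to time \<open>k + 1\<close>, so the time may be taken as \<open>k + n\<close> with \<open>n > 0\<close>, and f brings
  \<open>\<omega>\<^sub>k z\<^sub>1, \<omega>\<^sub>k z\<^sub>2\<close> close at time n.\<close>

lemma dist_le_sup_dist:
  fixes g h :: "'a::metric_space \<Rightarrow> 'a"
  assumes "bounded (UNIV :: 'a set)"
  shows "dist (g x) (h x) \<le> sup_dist g h"
proof -
  have "bdd_above (range (\<lambda>x. dist (g x) (h x)))"
    by (rule bdd_aboveI2[where M = "diameter (UNIV :: 'a set)"])
      (use diameter_bounded_bound[OF assms] in auto)
  then show ?thesis
    unfolding sup_dist_def by (rule cSUP_upper[OF UNIV_I])
qed

lemma surj_omega:
  assumes "nonautonomous_system F"
  shows "surj (omega F n)"
  using assms
  by (induction n) (auto simp: nonautonomous_system_def simp del: comp_apply intro!: comp_surj)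

lemma continuous_on_omega:
  assumes "nonautonomous_system F"
  shows "continuous_on UNIV (omega F n)"
proof (induction n)
  case (Suc n)
  have "continuous_on (range (omega F n)) (F (Suc n))"
    using assms by (auto simp: nonautonomous_system_def intro: continuous_on_subset)
  with Suc show ?case by (simp only: omega.simps continuous_on_compose)
qed simp

lemma commutes_with_funpow:
  assumes "commutes_with F f" and "n \<ge> 1"
  shows "F n ((f ^^ m) x) = (f ^^ m) (F n x)"
proof (induction m)
  case (Suc m)
  have "F n (f y) = f (F n y)" for y
    using assms by (auto simp: commutes_with_def fun_eq_iff)
  with Suc show ?case by simp
qed simp

lemma omega_funpow_commute:
  assumes "commutes_with F f"
  shows "omega F n ((f ^^ m) x) = (f ^^ m) (omega F n x)"
  by (induction n) (simp_all add: commutes_with_funpow[OF assms])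

text \<open>The induction on \<open>n\<close> absorbs the first map \<open>F (Suc k)\<close> into
  the initial segment. Since \<open>f ^^ n\<close> commutes with \<open>F (Suc k)\<close>, replacing
  that map by \<open>f\<close> costs only the distance of their values at the single point
  \<open>?w\<close>. The errors therefore add up without being amplified by later maps.\<close>

lemma dist_omega_add_le:
  fixes F :: "nat \<Rightarrow> 'a::metric_space \<Rightarrow> 'a"
  assumes bdd: "bounded (UNIV :: 'a set)" and comm: "commutes_with F f"
  shows "dist (omega F (k + n) x) ((f ^^ n) (omega F k x))
           \<le> (\<Sum>i\<in>{k..<k + n}. sup_dist (F (Suc i)) f)"
proof (induction n arbitrary: k)
  case (Suc n)
  let ?w = "(f ^^ n) (omega F k x)"
  have "dist (omega F (k + Suc n) x) ((f ^^ Suc n) (omega F k x))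
      \<le> dist (omega F (Suc k + n) x) ((f ^^ n) (omega F (Suc k) x)) + dist (F (Suc k) ?w) (f ?w)"
    using dist_triangle commutes_with_funpow[OF comm, of "Suc k" n "omega F k x"] by simp
  also have "\<dots> \<le> (\<Sum>i\<in>{Suc k..<Suc k + n}. sup_dist (F (Suc i)) f) + sup_dist (F (Suc k)) f"
    by (intro add_mono Suc.IH dist_le_sup_dist bdd)
  also have "\<dots> = (\<Sum>i\<in>{k..<k + Suc n}. sup_dist (F (Suc i)) f)"
    by (simp add: sum.atLeast_Suc_lessThan)
  finally show ?case .
qed simp

lemma omega_asymptotic:
  fixes F :: "nat \<Rightarrow> 'a::metric_space \<Rightarrow> 'a"
  assumes "bounded (UNIV :: 'a set)" "commutes_with F f" "converges_strongly F f" "\<epsilon> > 0"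
  obtains k where "\<And>n x. dist (omega F (k + n) x) ((f ^^ n) (omega F k x)) < \<epsilon>"
proof -
  obtain k where k: "norm (\<Sum>i\<in>{k..<m}. sup_dist (F (Suc i)) f) < \<epsilon>" for m
    using assms(3,4) unfolding converges_strongly_def summable_Cauchy by blast
  have "dist (omega F (k + n) x) ((f ^^ n) (omega F k x)) < \<epsilon>" for n x
    using dist_omega_add_le[OF assms(1,2), of k n x] k[of "k + n"] by simp
  then show thesis by (rule that)
qed

text \<open>One \<delta> serves every starting time \<open>m\<close> up to \<open>K\<close>, by
  uniform continuity of the finitely many maps in between. The case \<open>m = 0\<close> is uniform
  continuity of \<open>omega F K\<close>.\<close>

lemma omega_keeps_close:
  fixes F :: "nat \<Rightarrow> 'a::metric_space \<Rightarrow> 'a"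
  assumes sys: "nonautonomous_system F" and "\<epsilon> > 0"
  shows "\<exists>\<delta>>0. \<forall>m\<le>K. \<forall>x y. dist (omega F m x) (omega F m y) < \<delta>
           \<longrightarrow> dist (omega F K x) (omega F K y) < \<epsilon>"
  using \<open>\<epsilon> > 0\<close>
proof (induction K arbitrary: \<epsilon>)
  case (Suc K)
  have "uniformly_continuous_on UNIV (F (Suc K))"
    using sys by (auto simp: nonautonomous_system_def intro: compact_uniformly_continuous)
  then obtain \<eta> where "\<eta> > 0"
    and \<eta>: "\<And>x y. dist x y < \<eta> \<Longrightarrow> dist (F (Suc K) x) (F (Suc K) y) < \<epsilon>"
    using Suc.prems unfolding uniformly_continuous_on_def by (metis UNIV_I)
  from Suc.IH[OF \<open>\<eta> > 0\<close>] obtain \<delta> where "\<delta> > 0"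
    and \<delta>: "\<And>m x y. m \<le> K \<Longrightarrow> dist (omega F m x) (omega F m y) < \<delta>
                  \<Longrightarrow> dist (omega F K x) (omega F K y) < \<eta>"
    by blast
  \<comment> \<open>The bound \<delta> handles \<open>m \<le> K\<close>, the bound \<epsilon> the
    new case \<open>m = Suc K\<close>.\<close>
  have "dist (omega F (Suc K) x) (omega F (Suc K) y) < \<epsilon>"
    if "m \<le> Suc K" "dist (omega F m x) (omega F m y) < min \<delta> \<epsilon>" for m x y
    using that \<eta>[OF \<delta>[of m x y]] by (cases "m = Suc K") auto
  moreover have "min \<delta> \<epsilon> > 0"
    using \<open>\<delta> > 0\<close> Suc.prems by simp
  ultimately show ?case by blast
qed auto

lemma regionally_proximalE:
  assumes "regionally_proximal F" "\<epsilon> > 0" "open U" "x \<in> U" "open V" "y \<in> V"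
  obtains z1 z2 n where "z1 \<in> U" "z2 \<in> V" "n \<ge> 1" "dist (omega F n z1) (omega F n z2) < \<epsilon>"
  using assms unfolding regionally_proximal_def regionally_proximal_pair_def by blast

lemma regionally_proximalI:
  assumes "\<And>\<epsilon> U V x y. \<lbrakk>\<epsilon> > 0; open U; x \<in> U; open V; y \<in> V\<rbrakk> \<Longrightarrow>
             \<exists>z1\<in>U. \<exists>z2\<in>V. \<exists>n\<ge>1. dist (omega F n z1) (omega F n z2) < \<epsilon>"
  shows "regionally_proximal F"
  unfolding regionally_proximal_def regionally_proximal_pair_def
  using assms by blast

lemma dist_triangle_third:
  assumes "dist a b < \<epsilon> / 3" "dist b c < \<epsilon> / 3" "dist c d < \<epsilon> / 3"
  shows "dist a d < (\<epsilon>::real)"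
  using assms dist_triangle[of a d b] dist_triangle[of b d c] by linarith

theorem theorem5p2:
  fixes F :: "nat \<Rightarrow> 'a::metric_space \<Rightarrow> 'a" and f :: "'a \<Rightarrow> 'a"
  assumes "nonautonomous_system F"
    and "continuous_on UNIV f"
    and "commutes_with F f"
    and "converges_strongly F f"
  shows "regionally_proximal F \<longleftrightarrow> regionally_proximal (\<lambda>_. f)"
proof
  have bdd: "bounded (UNIV :: 'a set)"
    using assms(1) by (auto simp: nonautonomous_system_def intro: compact_imp_bounded)
  note asymptotic = omega_asymptotic[OF bdd assms(3,4)]
  {
    assume F: "regionally_proximal F"
    show "regionally_proximal (\<lambda>_. f)"
    proof (rule regionally_proximalI)
      fix \<epsilon> :: real and U V and x y :: 'a
      assume "\<epsilon> > 0" "open U" "x \<in> U" "open V" "y \<in> V"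
      then obtain k where k: "\<And>n x. dist (omega F (k + n) x) ((f ^^ n) (omega F k x)) < \<epsilon> / 3"
        using asymptotic[of "\<epsilon> / 3"] by auto
      \<comment> \<open>The horizon is \<open>Suc k\<close>, not \<open>k\<close>, so that an early
        meeting still yields a positive number of iterates of \<open>f\<close>.\<close>
      obtain \<delta> where "\<delta> > 0"
        and \<delta>: "\<And>m x y. m \<le> Suc k \<Longrightarrow> dist (omega F m x) (omega F m y) < \<delta>
                  \<Longrightarrow> dist (omega F (Suc k) x) (omega F (Suc k) y) < \<epsilon> / 3"
        using omega_keeps_close[OF assms(1), of "\<epsilon> / 3" "Suc k"] \<open>\<epsilon> > 0\<close> by auto
      obtain x' y' where xy': "omega F k x' = x" "omega F k y' = y"
        using surj_omega[OF assms(1)] by (metis surjD)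
      have open_pre: "open (omega F k -` W)" if "open W" for W
        using continuous_on_omega[OF assms(1)] that by (simp add: open_vimage)
      obtain z1 z2 m where z: "omega F k z1 \<in> U" "omega F k z2 \<in> V"
        and m: "dist (omega F m z1) (omega F m z2) < min \<delta> (\<epsilon> / 3)"
        by (rule regionally_proximalE[OF F, of "min \<delta> (\<epsilon> / 3)" "omega F k -` U" x'
              "omega F k -` V" y'])
          (use \<open>\<epsilon> > 0\<close> \<open>\<delta> > 0\<close> \<open>open U\<close> \<open>open V\<close> \<open>x \<in> U\<close> \<open>y \<in> V\<close> xy' open_pre in auto)
      \<comment> \<open>A meeting at time \<open>m \<le> Suc k\<close> is carried forward to
        \<open>k + 1\<close>; a later one already has the form \<open>k + n\<close> with
        \<open>n = m - k\<close>.\<close>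
      obtain n where "n \<ge> 1" and n: "dist (omega F (k + n) z1) (omega F (k + n) z2) < \<epsilon> / 3"
      proof (cases "m \<le> Suc k")
        case True
        with \<delta> m that[of 1] show thesis by simp
      next
        case False
        with m that[of "m - k"] show thesis by simp
      qed
      have "dist ((f ^^ n) (omega F k z1)) ((f ^^ n) (omega F k z2)) < \<epsilon>"
        by (rule dist_triangle_third[OF _ n k]) (subst dist_commute, rule k)
      with z \<open>n \<ge> 1\<close>
      show "\<exists>z1\<in>U. \<exists>z2\<in>V. \<exists>n\<ge>1. dist (omega (\<lambda>_. f) n z1) (omega (\<lambda>_. f) n z2) < \<epsilon>"
        unfolding omega_const by blast
    qed
  }
  {
    assume f: "regionally_proximal (\<lambda>_. f)"
    show "regionally_proximal F"
    proof (rule regionally_proximalI)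
      fix \<epsilon> :: real and U V and x y :: 'a
      assume "\<epsilon> > 0" "open U" "x \<in> U" "open V" "y \<in> V"
      then obtain k where k: "\<And>n x. dist (omega F (k + n) x) ((f ^^ n) (omega F k x)) < \<epsilon> / 3"
        using asymptotic[of "\<epsilon> / 3"] by auto
      \<comment> \<open>Only the starting time 0 is used here, where \<open>omega F 0\<close> is the
        identity.\<close>
      obtain \<delta> where "\<delta> > 0"
        and \<delta>: "\<And>x y. dist x y < \<delta> \<Longrightarrow> dist (omega F k x) (omega F k y) < \<epsilon> / 3"
        using omega_keeps_close[OF assms(1), of "\<epsilon> / 3" k] \<open>\<epsilon> > 0\<close>
        by (metis id_apply le0 omega.simps(1) zero_less_divide_iff zero_less_numeral)
      obtain z1 z2 n where z: "z1 \<in> U" "z2 \<in> V" "n \<ge> 1"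
        and n: "dist ((f ^^ n) z1) ((f ^^ n) z2) < \<delta>"
        using regionally_proximalE[OF f \<open>\<delta> > 0\<close> \<open>open U\<close> \<open>x \<in> U\<close> \<open>open V\<close> \<open>y \<in> V\<close>]
        unfolding omega_const by metis
      \<comment> \<open>Commutation lets \<open>omega F k\<close> act last, on the points that
        \<open>f ^^ n\<close> has already brought within \<delta>.\<close>
      have "dist ((f ^^ n) (omega F k z1)) ((f ^^ n) (omega F k z2)) < \<epsilon> / 3"
        using \<delta>[OF n] by (simp add: omega_funpow_commute[OF assms(3)])
      then have "dist (omega F (k + n) z1) (omega F (k + n) z2) < \<epsilon>"
        by (rule dist_triangle_third[OF k]) (subst dist_commute, rule k)
      moreover have "k + n \<ge> 1"
        using \<open>n \<ge> 1\<close> by simp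
      ultimately show "\<exists>z1\<in>U. \<exists>z2\<in>V. \<exists>n\<ge>1. dist (omega F n z1) (omega F n z2) < \<epsilon>"
        using z by blast
    qed
  }
qed

end
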